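(* Suppose $(Q,S)$ is a gentle quiver with potential, and $\pi=\beta_{m-1}\cdots\beta_2\beta_1$ is either a bypass or an almost bypass. Set $j_k:=s(\beta_k)$ for $k=1,2,\dots,m-1$ and $j_m:=t(\beta_{m-1})$, and denote by $\mathbf b_{j_k}$ the $j_k$-th column of the matrix $B=B_Q$. Then $$\sum_{k=1}^m\mathbf b_{j_k}=\begin{cases}2(-\mathbf e_{j_1}+\mathbf e_{j_m}) & \text{if }\pi\text{ is a bypass},\\ -\mathbf e_{j_1}+\mathbf e_{j_m} & \text{if }\pi\text{ is an almost bypass},\end{cases}$$ where $\mathbf e_i$ denotes the $i$-th standard basis vector.
   Context: $Q$ is a finite quiver with vertex set $\{1,\dots,n\}$, arrow set $Q_1$, arrows $a\colon s(a)\to t(a)$; paths are composed right to left. $B_Q=(b_{ij})$ is the $n\times n$ matrix $b_{ij}=\#\{\text{arrows }j\to i\}-\#\{\text{arrows }i\to j\}$. Let $\mathcal R$ be a finite set of paths on $Q$. $(Q,\mathcal R)$ is a gentle pair if: each vertex is the head of at most two arrows and the tail of at most two arrows; $\mathcal R$ consists of paths of length 2; if for some arrow $\alpha$ there exist two paths $\beta_1\alpha\ne\beta_2\alpha$ of length 2, then precisely one of them belongs to $\mathcal R$; if for some arrow $\beta$ there exist two different paths $\beta\alpha_1\neq\beta\alpha_2$ of length 2, then precisely one of them belongs to $\mathcal R$; and $\mathbb C\langle Q\rangle/\langle\mathcal R\rangle$ is finite-dimensional, where $\mathbb C\langle Q\rangle$ is the path algebra and $\langle\mathcal R\rangle$ the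 two-sided ideal generated by $\mathcal R$. A quiver with potential $(Q,S)$ is gentle if $Q$ has no loops and $(Q,\partial S)$ is a gentle pair, where $\partial S=\{\partial_a(S)\mid a\in Q_1\}$ is the set of cyclic derivatives (zero derivatives discarded). Let $(Q,\mathcal R)$ be a gentle pair and $\pi=\beta_{m-1}\cdots\beta_2\beta_1$ a path. $\pi$ is a bypass if $\beta_i\beta_{i-1}\notin\mathcal R$ for $i=2,\dots,m-1$ and there is an arrow $\beta_m\in Q_1\setminus\{\beta_1,\beta_{m-1}\}$ with $s(\beta_m)=s(\beta_1)$ and $t(\beta_m)=t(\beta_{m-1})$. $\pi$ is an almost bypass if $\beta_i\beta_{i-1}\notin\mathcal R$ for $i=2,\dots,m-1$ and there is a length-2 path $\beta_{m+1}\beta_m$ with $\beta_{m+1},\beta_m\in Q_1\setminus\{\beta_1,\beta_{m-1}\}$, $\beta_{m+1}\beta_m\notin\mathcal R$, $s(\beta_m)=s(\beta_1)$, $t(\beta_{m+1})=t(\beta_{m-1})$, such that the only arrows of $Q$ incident to $t(\beta_m)=s(\beta_{m+1})$ are $\beta_m$ and $\beta_{m+1}$. For $(Q,S)$ gentle, these notions are taken with $\mathcal R=\partial S$. *)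

theory Defs
  imports
    "HOL-Analysis.Analysis"
    "HOL-Algebra.Algebra"
    "Graph_Theory.Digraph"
    "Graph_Theory.Arc_Walk"
begin

text \<open>
  Quivers are the finite multidigraphs (possibly with loops) \<open>fin_digraph\<close> of \<open>Graph_Theory\<close>.
  A path is a pair of its starting vertex and its list of arrows in order of traversal, so the
  path written \<open>\<beta>\<^sub>r \<cdots> \<beta>\<^sub>1\<close> (composition from right to left) is \<open>(s(\<beta>\<^sub>1), [\<beta>\<^sub>1, \<dots>, \<beta>\<^sub>r])\<close>, and the
  trivial path at \<open>v\<close> is \<open>(v, [])\<close>.
\<close>

type_synonym ('v, 'a) qpath = "'v \<times> 'a list"

definition qpaths :: "('v, 'a) pre_digraph \<Rightarrow> ('v, 'a) qpath set" where
  "qpaths Q = {(u, as) | u as. \<exists>v. pre_digraph.awalk Q u as v}"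

definition qtarget :: "('v, 'a) pre_digraph \<Rightarrow> ('v, 'a) qpath \<Rightarrow> 'v" where
  "qtarget Q p = last (pre_digraph.awalk_verts Q (fst p) (snd p))"

text \<open>\<open>qcat q p\<close> is the path \<open>qp\<close>, i.e. first \<open>p\<close> and then \<open>q\<close>.\<close>

definition qcat :: "('v, 'a) qpath \<Rightarrow> ('v, 'a) qpath \<Rightarrow> ('v, 'a) qpath" where
  "qcat q p = (fst p, snd p @ snd q)"

definition arrow_path2 :: "('v, 'a) pre_digraph \<Rightarrow> 'a \<Rightarrow> 'a \<Rightarrow> ('v, 'a) qpath" where
  "arrow_path2 Q b a = (tail Q a, [a, b])"

definition qcompositions ::
  "('v, 'a) pre_digraph \<Rightarrow> ('v, 'a) qpath \<Rightarrow> (('v, 'a) qpath \<times> ('v, 'a) qpath) set" where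
  "qcompositions Q p =
    {(q, r). q \<in> qpaths Q \<and> r \<in> qpaths Q \<and> fst q = qtarget Q r \<and> qcat q r = p}"

text \<open>
  Elements of the path algebra are the finitely supported coefficient functions on paths.
\<close>

definition path_algebra ::
  "('v, 'a) pre_digraph \<Rightarrow> (('v, 'a) qpath \<Rightarrow> complex) ring" where
  "path_algebra Q =
    \<lparr>carrier = {f. finite {p. f p \<noteq> 0} \<and> {p. f p \<noteq> 0} \<subseteq> qpaths Q},
     monoid.mult = (\<lambda>f g p. \<Sum>(q, r) \<in> qcompositions Q p. f q * g r),
     monoid.one = (\<lambda>p. of_bool (\<exists>v \<in> verts Q. p = (v, []))),
     ring.zero = (\<lambda>p. 0),
     ring.add = (\<lambda>f g p. f p + g p)\<rparr>"

definition qbasis :: "('v, 'a) qpath \<Rightarrow> ('v, 'a) qpath \<Rightarrow> complex" where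
  "qbasis p = (\<lambda>q. of_bool (q = p))"

text \<open>
  The library notion of dimension is relative to a subfield of the ring; for the quotient
  of the path algebra by the ideal generated by \<open>R\<close> this is the image of the scalars
  \<open>c \<cdot> 1\<close>, \<open>c \<in> \<complex>\<close>.
\<close>

definition finite_dimensional_quotient ::
  "('v, 'a) pre_digraph \<Rightarrow> ('v, 'a) qpath set \<Rightarrow> bool" where
  "finite_dimensional_quotient Q R \<longleftrightarrow>
    (let A = path_algebra Q; I = Idl\<^bsub>A\<^esub> (qbasis ` R);
         K = range (\<lambda>c. I +>\<^bsub>A\<^esub> (\<lambda>p. c * \<one>\<^bsub>A\<^esub> p))
     in ring.finite_dimension (A Quot I) K (carrier (A Quot I)))"

definition gentle_pair :: "('v, 'a) pre_digraph \<Rightarrow> ('v, 'a) qpath set \<Rightarrow> bool" where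
  "gentle_pair Q R \<longleftrightarrow>
    finite R \<and> R \<subseteq> qpaths Q \<and>
    (\<forall>v \<in> verts Q. in_degree Q v \<le> 2 \<and> out_degree Q v \<le> 2) \<and>
    (\<forall>p \<in> R. length (snd p) = 2) \<and>
    (\<forall>a \<in> arcs Q. \<forall>b1 \<in> arcs Q. \<forall>b2 \<in> arcs Q.
       b1 \<noteq> b2 \<and> head Q a = tail Q b1 \<and> head Q a = tail Q b2 \<longrightarrow>
       (arrow_path2 Q b1 a \<in> R) \<noteq> (arrow_path2 Q b2 a \<in> R)) \<and>
    (\<forall>b \<in> arcs Q. \<forall>a1 \<in> arcs Q. \<forall>a2 \<in> arcs Q.
       a1 \<noteq> a2 \<and> head Q a1 = tail Q b \<and> head Q a2 = tail Q b \<longrightarrow>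
       (arrow_path2 Q b a1 \<in> R) \<noteq> (arrow_path2 Q b a2 \<in> R)) \<and>
    finite_dimensional_quotient Q R"

definition qcycles :: "('v, 'a) pre_digraph \<Rightarrow> ('v, 'a) qpath set" where
  "qcycles Q = {c \<in> qpaths Q. snd c \<noteq> [] \<and> qtarget Q c = fst c}"

text \<open>
  A potential is a possibly infinite linear combination of cyclic paths of positive length (an
  element of the complete path algebra); potentials in the path algebra itself are a special case.
\<close>

definition potential :: "('v, 'a) pre_digraph \<Rightarrow> (('v, 'a) qpath \<Rightarrow> complex) \<Rightarrow> bool" where
  "potential Q S \<longleftrightarrow> {c. S c \<noteq> 0} \<subseteq> qcycles Q"

text \<open>
  For a cyclic path \<open>c = a\<^sub>1 \<cdots> a\<^sub>d\<close> (right to left),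
  \<open>\<partial>\<^sub>a(c) = \<Sum>\<^bsub>a\<^sub>k = a\<^esub> a\<^sub>k\<^sub>+\<^sub>1 \<cdots> a\<^sub>d a\<^sub>1 \<cdots> a\<^sub>k\<^sub>-\<^sub>1\<close>. In traversal order the summand consists of the
  arrows after the chosen occurrence of \<open>a\<close> followed by those before it.
\<close>

definition cyclic_derivative_path ::
  "('v, 'a) pre_digraph \<Rightarrow> 'a \<Rightarrow> ('v, 'a) qpath \<Rightarrow> ('v, 'a) qpath \<Rightarrow> complex" where
  "cyclic_derivative_path Q a c = (\<lambda>p.
    \<Sum>k | k < length (snd c) \<and> snd c ! k = a.
      qbasis (head Q a, drop (Suc k) (snd c) @ take k (snd c)) p)"

text \<open>
  Continuous linear extension: only cycles one longer than \<open>p\<close> contribute to the coefficient at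
  \<open>p\<close>, and a quiver has finitely many of these.
\<close>

definition cyclic_derivative ::
  "('v, 'a) pre_digraph \<Rightarrow> 'a \<Rightarrow> (('v, 'a) qpath \<Rightarrow> complex) \<Rightarrow> ('v, 'a) qpath \<Rightarrow> complex" where
  "cyclic_derivative Q a S = (\<lambda>p.
    \<Sum>c | c \<in> qcycles Q \<and> length (snd c) = Suc (length (snd p)).
      S c * cyclic_derivative_path Q a c p)"

definition cyclic_derivatives ::
  "('v, 'a) pre_digraph \<Rightarrow> (('v, 'a) qpath \<Rightarrow> complex) \<Rightarrow> (('v, 'a) qpath \<Rightarrow> complex) set" where
  "cyclic_derivatives Q S = {cyclic_derivative Q a S | a. a \<in> arcs Q} - {\<lambda>p. 0}"

text \<open>
  \<open>derivative_paths Q S\<close> consists of the paths lying in \<open>\<partial>S\<close>; for \<open>(Q, S)\<close> to be gentle, all of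
  \<open>\<partial>S\<close> has to consist of paths.
\<close>

definition derivative_paths ::
  "('v, 'a) pre_digraph \<Rightarrow> (('v, 'a) qpath \<Rightarrow> complex) \<Rightarrow> ('v, 'a) qpath set" where
  "derivative_paths Q S = {p \<in> qpaths Q. qbasis p \<in> cyclic_derivatives Q S}"

definition gentle_qp :: "('v, 'a) pre_digraph \<Rightarrow> (('v, 'a) qpath \<Rightarrow> complex) \<Rightarrow> bool" where
  "gentle_qp Q S \<longleftrightarrow>
    potential Q S \<and> loopfree_digraph Q \<and>
    cyclic_derivatives Q S = qbasis ` derivative_paths Q S \<and>
    gentle_pair Q (derivative_paths Q S)"

definition relation_free ::
  "('v, 'a) pre_digraph \<Rightarrow> ('v, 'a) qpath set \<Rightarrow> 'a list \<Rightarrow> bool" where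
  "relation_free Q R as \<longleftrightarrow>
    (\<forall>i. Suc i < length as \<longrightarrow> arrow_path2 Q (as ! Suc i) (as ! i) \<notin> R)"

definition is_bypass ::
  "('v, 'a) pre_digraph \<Rightarrow> ('v, 'a) qpath set \<Rightarrow> ('v, 'a) qpath \<Rightarrow> bool" where
  "is_bypass Q R p \<longleftrightarrow>
    p \<in> qpaths Q \<and> snd p \<noteq> [] \<and> relation_free Q R (snd p) \<and>
    (\<exists>b \<in> arcs Q - {hd (snd p), last (snd p)}.
       tail Q b = tail Q (hd (snd p)) \<and> head Q b = head Q (last (snd p)))"

definition is_almost_bypass ::
  "('v, 'a) pre_digraph \<Rightarrow> ('v, 'a) qpath set \<Rightarrow> ('v, 'a) qpath \<Rightarrow> bool" where
  "is_almost_bypass Q R p \<longleftrightarrow>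
    p \<in> qpaths Q \<and> snd p \<noteq> [] \<and> relation_free Q R (snd p) \<and>
    (\<exists>b \<in> arcs Q - {hd (snd p), last (snd p)}. \<exists>b' \<in> arcs Q - {hd (snd p), last (snd p)}.
       head Q b = tail Q b' \<and> arrow_path2 Q b' b \<notin> R \<and>
       tail Q b = tail Q (hd (snd p)) \<and> head Q b' = head Q (last (snd p)) \<and>
       in_arcs Q (head Q b) \<union> out_arcs Q (head Q b) = {b, b'})"

definition quiver_matrix :: "('v::finite, 'a) pre_digraph \<Rightarrow> int ^ 'v ^ 'v" where
  "quiver_matrix Q = (\<chi> i j.
     int (card {a \<in> arcs Q. tail Q a = j \<and> head Q a = i})
     - int (card {a \<in> arcs Q. tail Q a = i \<and> head Q a = j}))"


text \<open>
  The path algebra is a ring, so the ideal and the quotient above are the intended ones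
  (\<open>Idl\<close> is defined through \<open>ideal I A\<close>, which includes \<open>ring A\<close>).
\<close>

lemma qpaths_iff:
  "p \<in> qpaths Q \<longleftrightarrow>
    fst p \<in> verts Q \<and> set (snd p) \<subseteq> arcs Q \<and> pre_digraph.cas Q (fst p) (snd p) (qtarget Q p)"
proof -
  have last: "last (pre_digraph.awalk_verts Q u as) = v" if "pre_digraph.cas Q u as v" for u as v
    using that
  proof (induction as arbitrary: u)
    case Nil
    then show ?case
      by (simp add: pre_digraph.cas.simps pre_digraph.awalk_verts.simps)
  next
    case (Cons a as)
    have "pre_digraph.awalk_verts Q (head Q a) as \<noteq> []"
      by (cases as) (simp_all add: pre_digraph.awalk_verts.simps)
    with Cons show ?case
      by (simp add: pre_digraph.cas.simps pre_digraph.awalk_verts.simps)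
  qed
  show ?thesis
    by (cases p) (auto simp: qpaths_def qtarget_def pre_digraph.awalk_def dest: last)
qed

lemma qtarget_Nil [simp]: "qtarget Q (u, []) = u"
  by (simp add: qtarget_def pre_digraph.awalk_verts.simps)

lemma qtarget_Cons: "qtarget Q (u, a # as) = qtarget Q (head Q a, as)"
proof -
  have "pre_digraph.awalk_verts Q (head Q a) as \<noteq> []"
    by (cases as) (simp_all add: pre_digraph.awalk_verts.simps)
  then show ?thesis by (simp add: qtarget_def pre_digraph.awalk_verts.simps)
qed

lemma cas_append:
  "pre_digraph.cas Q u (as @ bs) v \<longleftrightarrow>
    (\<exists>w. pre_digraph.cas Q u as w \<and> pre_digraph.cas Q w bs v)"
  by (induction as arbitrary: u) (auto simp: pre_digraph.cas.simps)

lemma qtarget_append: "qtarget Q (u, as @ bs) = qtarget Q (qtarget Q (u, as), bs)"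
  by (induction as arbitrary: u) (simp_all add: qtarget_Cons)

lemma qtarget_qcat: "fst q = qtarget Q p \<Longrightarrow> qtarget Q (qcat q p) = qtarget Q q"
  by (cases p; cases q) (simp add: qcat_def qtarget_append)

lemma qcat_in_qpaths:
  assumes "q \<in> qpaths Q" "p \<in> qpaths Q" "fst q = qtarget Q p"
  shows "qcat q p \<in> qpaths Q"
proof -
  have "pre_digraph.cas Q (fst p) (snd p @ snd q) (qtarget Q q)"
    using assms by (auto simp: cas_append qpaths_iff)
  then show ?thesis
    using assms by (simp add: qpaths_iff qtarget_qcat) (simp add: qcat_def)
qed

lemma append_in_qpaths:
  "(u, as) \<in> qpaths Q \<Longrightarrow> (qtarget Q (u, as), bs) \<in> qpaths Q \<Longrightarrow> (u, as @ bs) \<in> qpaths Q"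
  using qcat_in_qpaths[of "(qtarget Q (u, as), bs)" Q "(u, as)"] by (simp add: qcat_def)

lemma finite_qcompositions: "finite (qcompositions Q p)"
proof (rule finite_subset)
  let ?f = "\<lambda>k. ((qtarget Q (fst p, take k (snd p)), drop k (snd p)), (fst p, take k (snd p)))"
  show "qcompositions Q p \<subseteq> ?f ` {..length (snd p)}"
  proof
    fix x assume "x \<in> qcompositions Q p"
    then have "x = ?f (length (snd (snd x)))" "length (snd (snd x)) \<le> length (snd p)"
      by (cases x; cases p; force simp: qcompositions_def qcat_def)+
    then show "x \<in> ?f ` {..length (snd p)}" by blast
  qed
qed simp

lemma qcompositions_sum_assoc:
  fixes h :: "('v, 'a) qpath \<Rightarrow> ('v, 'a) qpath \<Rightarrow> ('v, 'a) qpath \<Rightarrow> complex"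
  shows "(\<Sum>(x, r) \<in> qcompositions Q p. \<Sum>(s, t) \<in> qcompositions Q x. h s t r) =
         (\<Sum>(s, y) \<in> qcompositions Q p. \<Sum>(t, r) \<in> qcompositions Q y. h s t r)"
proof -
  have "(\<Sum>(x, r) \<in> qcompositions Q p. \<Sum>(s, t) \<in> qcompositions Q x. h s t r) =
        (\<Sum>z \<in> Sigma (qcompositions Q p) (\<lambda>z. qcompositions Q (fst z)).
           h (fst (snd z)) (snd (snd z)) (snd (fst z)))"
    by (simp add: case_prod_unfold sum.Sigma finite_qcompositions)
  also have "\<dots> = (\<Sum>z \<in> Sigma (qcompositions Q p) (\<lambda>z. qcompositions Q (snd z)).
           h (fst (fst z)) (fst (snd z)) (snd (snd z)))"
    by (rule sum.reindex_bij_witness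
        [where i = "\<lambda>z. ((qcat (fst (fst z)) (fst (snd z)), snd (snd z)), (fst (fst z), fst (snd z)))"
           and j = "\<lambda>z. ((fst (snd z), qcat (snd (snd z)) (snd (fst z))), (snd (snd z), snd (fst z)))"])
      (auto simp: qcompositions_def qcat_def qtarget_append intro!: append_in_qpaths)
  also have "\<dots> = (\<Sum>(s, y) \<in> qcompositions Q p. \<Sum>(t, r) \<in> qcompositions Q y. h s t r)"
    by (simp add: case_prod_unfold sum.Sigma finite_qcompositions)
  finally show ?thesis .
qed

lemma ring_path_algebra:
  fixes Q :: "('v, 'a) pre_digraph"
  assumes "fin_digraph Q"
  shows "ring (path_algebra Q)"
proof (rule ringI)
  let ?A = "path_algebra Q"
  have add_closed: "x \<oplus>\<^bsub>?A\<^esub> y \<in> carrier ?A" if "x \<in> carrier ?A" "y \<in> carrier ?A" for x y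
  proof -
    have "{p. x p + y p \<noteq> 0} \<subseteq> {p. x p \<noteq> 0} \<union> {p. y p \<noteq> 0}" by auto
    with that show ?thesis
      by (auto simp: path_algebra_def intro: finite_subset)
  qed
  show "abelian_group ?A"
  proof (rule abelian_groupI)
    fix x assume x: "x \<in> carrier ?A"
    then have "(\<lambda>p. - x p) \<in> carrier ?A" "(\<lambda>p. - x p) \<oplus>\<^bsub>?A\<^esub> x = \<zero>\<^bsub>?A\<^esub>"
      by (auto simp: path_algebra_def)
    then show "\<exists>y \<in> carrier ?A. y \<oplus>\<^bsub>?A\<^esub> x = \<zero>\<^bsub>?A\<^esub>" by blast
  qed (use add_closed in \<open>auto simp: path_algebra_def add_ac\<close>)
  show "Group.monoid ?A"
  proof (rule monoidI)
    fix x y assume x: "x \<in> carrier ?A" and y: "y \<in> carrier ?A"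
    let ?X = "{p. x p \<noteq> 0}" and ?Y = "{p. y p \<noteq> 0}"
    let ?Z = "{p. (\<Sum>(q, r) \<in> qcompositions Q p. x q * y r) \<noteq> 0}"
    have Z: "\<exists>q r. (q, r) \<in> qcompositions Q p \<and> x q \<noteq> 0 \<and> y r \<noteq> 0" if "p \<in> ?Z" for p
    proof -
      from that obtain z where "z \<in> qcompositions Q p" "x (fst z) * y (snd z) \<noteq> 0"
        by (metis (mono_tags, lifting) case_prod_unfold mem_Collect_eq sum.not_neutral_contains_not_neutral)
      then show ?thesis by (cases z) auto
    qed
    have "?Z \<subseteq> (\<lambda>(q, r). qcat q r) ` (?X \<times> ?Y)"
    proof
      fix p assume "p \<in> ?Z"
      from Z[OF this] obtain q r where "(q, r) \<in> qcompositions Q p" "x q \<noteq> 0" "y r \<noteq> 0" by blast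
      then show "p \<in> (\<lambda>(q, r). qcat q r) ` (?X \<times> ?Y)"
        by (auto simp: qcompositions_def intro!: image_eqI[of _ _ "(q, r)"])
    qed
    moreover have "finite ((\<lambda>(q, r). qcat q r) ` (?X \<times> ?Y))"
      using x y by (simp add: path_algebra_def)
    ultimately have "finite ?Z" by (rule finite_subset)
    moreover have "?Z \<subseteq> qpaths Q"
    proof
      fix p assume "p \<in> ?Z"
      from Z[OF this] show "p \<in> qpaths Q"
        by (auto simp: qcompositions_def qcat_in_qpaths)
    qed
    ultimately show "x \<otimes>\<^bsub>?A\<^esub> y \<in> carrier ?A"
      by (simp add: path_algebra_def)
  next
    have "{p. (of_bool (\<exists>v \<in> verts Q. p = (v, [])) :: complex) \<noteq> 0} = (\<lambda>v. (v, [])) ` verts Q"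
      by auto
    then show "\<one>\<^bsub>?A\<^esub> \<in> carrier ?A"
      using fin_digraph.finite_verts[OF assms]
      by (auto simp: path_algebra_def qpaths_iff pre_digraph.cas.simps)
  next
    fix x y z assume "x \<in> carrier ?A" "y \<in> carrier ?A" "z \<in> carrier ?A"
    have "(\<Sum>(u, r) \<in> qcompositions Q p. (\<Sum>(s, t) \<in> qcompositions Q u. x s * y t) * z r) =
          (\<Sum>(s, u) \<in> qcompositions Q p. x s * (\<Sum>(t, r) \<in> qcompositions Q u. y t * z r))" for p
      using qcompositions_sum_assoc[of "\<lambda>s t r. x s * y t * z r" Q p]
      by (simp add: sum_distrib_left sum_distrib_right case_prod_unfold mult.assoc)
    then show "x \<otimes>\<^bsub>?A\<^esub> y \<otimes>\<^bsub>?A\<^esub> z = x \<otimes>\<^bsub>?A\<^esub> (y \<otimes>\<^bsub>?A\<^esub> z)"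
      by (simp add: path_algebra_def)
  next
    fix x assume x: "x \<in> carrier ?A"
    have "(\<Sum>(q, r) \<in> qcompositions Q p. of_bool (\<exists>v \<in> verts Q. q = (v, [])) * x r) = x p" for p
    proof (cases "p \<in> qpaths Q")
      case True
      have "(\<Sum>(q, r) \<in> qcompositions Q p. of_bool (\<exists>v \<in> verts Q. q = (v, [])) * x r) =
            (\<Sum>(q, r) \<in> {((qtarget Q p, [] :: 'a list), p)}. x r)"
      proof (rule sum.mono_neutral_cong_right[OF finite_qcompositions])
        have "qtarget Q p \<in> verts Q"
          using True assms
          by (auto simp: qpaths_def qtarget_def pre_digraph.awalk_def
              intro!: wf_digraph.awlast_in_verts fin_digraph.axioms(1))
        then show "{((qtarget Q p, [] :: 'a list), p)} \<subseteq> qcompositions Q p"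
          using True by (auto simp: qcompositions_def qcat_def qpaths_iff pre_digraph.cas.simps)
        show "\<forall>i \<in> qcompositions Q p - {((qtarget Q p, [] :: 'a list), p)}.
            (case i of (q, r) \<Rightarrow> of_bool (\<exists>v \<in> verts Q. q = (v, [])) * x r) = 0"
          by (auto simp: qcompositions_def qcat_def)
        show "(case i of (q, r) \<Rightarrow> of_bool (\<exists>v \<in> verts Q. q = (v, [])) * x r) = (case i of (q, r) \<Rightarrow> x r)"
          if "i \<in> {((qtarget Q p, [] :: 'a list), p)}" for i
          using that \<open>qtarget Q p \<in> verts Q\<close> by auto
      qed
      then show ?thesis by simp
    next
      case False
      then have "qcompositions Q p = {}" by (auto simp: qcompositions_def qcat_in_qpaths)
      with False x show ?thesis by (auto simp: path_algebra_def)
    qed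
    then show "\<one>\<^bsub>?A\<^esub> \<otimes>\<^bsub>?A\<^esub> x = x" by (simp add: path_algebra_def)
    have "(\<Sum>(q, r) \<in> qcompositions Q p. x q * of_bool (\<exists>v \<in> verts Q. r = (v, []))) = x p" for p
    proof (cases "p \<in> qpaths Q")
      case True
      have "(\<Sum>(q, r) \<in> qcompositions Q p. x q * of_bool (\<exists>v \<in> verts Q. r = (v, []))) =
            (\<Sum>(q, r) \<in> {(p, (fst p, [] :: 'a list))}. x q)"
      proof (rule sum.mono_neutral_cong_right[OF finite_qcompositions])
        have "fst p \<in> verts Q" using True by (simp add: qpaths_iff)
        then show "{(p, (fst p, [] :: 'a list))} \<subseteq> qcompositions Q p"
          using True by (auto simp: qcompositions_def qcat_def qpaths_iff pre_digraph.cas.simps)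
        show "\<forall>i \<in> qcompositions Q p - {(p, (fst p, [] :: 'a list))}.
            (case i of (q, r) \<Rightarrow> x q * of_bool (\<exists>v \<in> verts Q. r = (v, []))) = 0"
          by (auto simp: qcompositions_def qcat_def)
        show "(case i of (q, r) \<Rightarrow> x q * of_bool (\<exists>v \<in> verts Q. r = (v, []))) = (case i of (q, r) \<Rightarrow> x q)"
          if "i \<in> {(p, (fst p, [] :: 'a list))}" for i
          using that \<open>fst p \<in> verts Q\<close> by auto
      qed
      then show ?thesis by simp
    next
      case False
      then have "qcompositions Q p = {}" by (auto simp: qcompositions_def qcat_in_qpaths)
      with False x show ?thesis by (auto simp: path_algebra_def)
    qed
    then show "x \<otimes>\<^bsub>?A\<^esub> \<one>\<^bsub>?A\<^esub> = x" by (simp add: path_algebra_def)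
  qed
qed (simp_all add: path_algebra_def distrib_left distrib_right sum.distrib case_prod_unfold)

end

theory Submission
  imports Defs
begin

text \<open>
  The \<open>v\<close>-th column of the quiver matrix is the sum of the basis vectors at the heads of the arrows
  leaving \<open>v\<close> minus the sum of those at the tails of the arrows entering \<open>v\<close>. The proposition thus
  counts, along \<open>\<pi>\<close>, the arrows of the path, the arrows of the bypass, and all further
  arrows attached to the vertices of the path; the point is that the last kind cancels.

  The reason is that the relations come from a potential. A relation \<open>\<beta>\<alpha> = \<partial>\<^sub>\<gamma>(S)\<close> arises from an
  oriented triangle \<open>\<gamma>\<beta>\<alpha>\<close>, and since cyclic derivatives do not distinguish the rotations of a
  triangle, \<open>\<gamma>\<beta>\<close> and \<open>\<alpha>\<gamma>\<close> occur in \<open>\<partial>\<^sub>\<alpha>(S)\<close> and \<open>\<partial>\<^sub>\<beta>(S)\<close>, which are themselves single paths: they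
  are relations as well (\<open>gentle_qp_relations_rotate\<close>). Gentleness allows at most one \<open>\<alpha>\<close> with \<open>\<beta>\<alpha>\<close>
  a relation and at most one \<open>\<gamma>\<close> with \<open>\<gamma>\<beta>\<close> a relation. So an arrow \<open>\<beta>\<close> either
  takes part in no relation, or it has a well-defined opposite vertex \<open>s(\<alpha>) = t(\<gamma>)\<close>, whose basis
  vector is \<open>apex \<beta>\<close>.

  At an interior vertex of \<open>\<pi>\<close>, with \<open>p\<close> the arrow of \<open>\<pi>\<close> coming in and \<open>q\<close> the one going out, any
  further incoming arrow \<open>a\<close> makes \<open>qa\<close> a relation and any further outgoing arrow \<open>c\<close> makes \<open>cp\<close> a
  relation, because \<open>qp\<close> is not one. The further arrows therefore contribute \<open>apex p - apex q\<close>, and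
  these terms telescope along the path. At the first vertex the two outgoing arrows are \<open>\<beta>\<^sub>1\<close> and
  the first arrow \<open>b\<close> of the bypass, and every incoming arrow is in relation with exactly one of them;
  dually at the last vertex, where the last arrow \<open>b'\<close> of the bypass comes in. What survives is the
  contribution of \<open>b\<close> and \<open>b'\<close> (\<open>sum_columns_along_path\<close>), in which \<open>apex b\<close> and \<open>apex b'\<close> cancel if
  \<open>b = b'\<close> and both vanish for an almost bypass.
\<close>

section \<open>Relations of a quiver with potential and oriented triangles\<close>

text \<open>
  On a cycle of length 3 the coefficient of \<open>\<partial>\<^sub>x\<close> at a path of length 2 counts the rotations of the
  cycle that spell \<open>x, y, z\<close>. In this form it is visibly invariant under rotating \<open>x, y, z\<close>.
\<close>

lemma cyclic_derivative_path_of_triangle: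
  "cyclic_derivative_path Q x (u, [c0, c1, c2]) (head Q x, [y, z]) =
     of_bool ([c0, c1, c2] = [x, y, z]) + of_bool ([c1, c2, c0] = [x, y, z])
       + of_bool ([c2, c0, c1] = [x, y, z])"
proof -
  let ?as = "[c0, c1, c2]"
  have "cyclic_derivative_path Q x (u, ?as) (head Q x, [y, z]) =
      (\<Sum>k | k \<in> {..<3} \<and> ?as ! k = x.
         of_bool ((head Q x, [y, z]) = (head Q x, drop (Suc k) ?as @ take k ?as)))"
    unfolding cyclic_derivative_path_def qbasis_def by (simp add: numeral_3_eq_3)
  also have "\<dots> = (\<Sum>k<3. if ?as ! k = x
         then of_bool ((head Q x, [y, z]) = (head Q x, drop (Suc k) ?as @ take k ?as)) else 0)"
    by (rule sum.inter_filter) simp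
  also have "\<dots> = (\<Sum>k<3. of_bool (?as ! k = x \<and> drop (Suc k) ?as @ take k ?as = [y, z]))"
    by (intro sum.cong) auto
  also have "\<dots> = of_bool (?as = [x, y, z]) + of_bool ([c1, c2, c0] = [x, y, z])
       + of_bool ([c2, c0, c1] = [x, y, z])"
    by (simp add: numeral_3_eq_3)
  finally show ?thesis .
qed

lemma cyclic_derivative_rotate:
  "cyclic_derivative Q x S (head Q x, [y, z]) = cyclic_derivative Q y S (head Q y, [z, x])"
proof -
  have "cyclic_derivative_path Q x c (head Q x, [y, z])
      = cyclic_derivative_path Q y c (head Q y, [z, x])" if "length (snd c) = 3" for c
  proof -
    from that obtain u c0 c1 c2 where "c = (u, [c0, c1, c2])"
      by (cases c) (auto simp: numeral_3_eq_3 length_Suc_conv)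
    then show ?thesis
      by (simp add: cyclic_derivative_path_of_triangle conj_ac add_ac)
  qed
  then show ?thesis
    unfolding cyclic_derivative_def by (intro sum.cong) auto
qed

lemma derivative_path_starts_at_head:
  assumes "cyclic_derivative Q x S (u, as) \<noteq> 0"
  shows "u = head Q x"
proof (rule ccontr)
  assume "u \<noteq> head Q x"
  then have "cyclic_derivative_path Q x c (u, as) = 0" for c
    by (simp add: cyclic_derivative_path_def qbasis_def)
  with assms show False
    by (simp add: cyclic_derivative_def)
qed

text \<open>
  If \<open>ba = \<partial>\<^sub>c(S)\<close>, then \<open>cb\<close> and \<open>ac\<close> have nonzero coefficients in \<open>\<partial>\<^sub>a(S)\<close> and \<open>\<partial>\<^sub>b(S)\<close>. A nonzero
  cyclic derivative of a gentle potential is a single path, so these derivatives are \<open>cb\<close> and \<open>ac\<close>.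
\<close>

lemma gentle_qp_relations_rotate:
  assumes gentle: "gentle_qp Q S" and rel: "arrow_path2 Q b a \<in> derivative_paths Q S"
  obtains c where "arrow_path2 Q c b \<in> derivative_paths Q S"
    and "arrow_path2 Q a c \<in> derivative_paths Q S"
proof -
  let ?R = "derivative_paths Q S"
  have ab: "a \<in> arcs Q" "b \<in> arcs Q" "head Q a = tail Q b"
    using rel by (auto simp: derivative_paths_def arrow_path2_def qpaths_iff pre_digraph.cas.simps)
  have path_if_coeff: "(head Q x, [y, z]) \<in> ?R"
    if "x \<in> arcs Q" "cyclic_derivative Q x S (head Q x, [y, z]) \<noteq> 0" for x y z
  proof -
    have "cyclic_derivative Q x S \<in> cyclic_derivatives Q S"
      using that by (auto simp: cyclic_derivatives_def)
    then obtain q where "q \<in> ?R" "cyclic_derivative Q x S = qbasis q"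
      using gentle by (auto simp: gentle_qp_def)
    with that(2) show ?thesis
      by (auto simp: qbasis_def split: if_splits)
  qed
  from rel obtain c where c: "c \<in> arcs Q" "qbasis (tail Q a, [a, b]) = cyclic_derivative Q c S"
    by (auto simp: derivative_paths_def cyclic_derivatives_def arrow_path2_def)
  then have nz: "cyclic_derivative Q c S (tail Q a, [a, b]) \<noteq> 0"
    by (simp add: qbasis_def flip: c(2))
  then have ca: "tail Q a = head Q c"
    by (rule derivative_path_starts_at_head)
  have "(head Q a, [b, c]) \<in> ?R"
    using nz ca ab by (intro path_if_coeff) (simp_all flip: cyclic_derivative_rotate)
  moreover have "(head Q b, [c, a]) \<in> ?R"
    using nz ca ab by (intro path_if_coeff) (simp_all flip: cyclic_derivative_rotate)
  moreover have "head Q b = tail Q c"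
    using \<open>(head Q b, [c, a]) \<in> ?R\<close>
    by (auto simp: derivative_paths_def qpaths_iff pre_digraph.cas.simps)
  ultimately show thesis
    using ab(3) by (intro that) (simp_all add: arrow_path2_def)
qed

section \<open>Columns of the quiver matrix along relation-free paths\<close>

text \<open>
  The combinatorial content of a gentle quiver with potential: the local conditions of a gentle pair
  together with closure of the relations under rotation of triangles.
\<close>

locale triangle_relations = fin_digraph Q for Q :: "('v::finite, 'a) pre_digraph" +
  fixes R :: "('v, 'a) qpath set"
  assumes relation_paths: "R \<subseteq> qpaths Q"
    and degree_le_2: "v \<in> verts Q \<Longrightarrow> in_degree Q v \<le> 2 \<and> out_degree Q v \<le> 2"
    and relation_split_out:
      "\<lbrakk>a \<in> arcs Q; c \<in> arcs Q; c' \<in> arcs Q; c \<noteq> c'; head Q a = tail Q c; head Q a = tail Q c'\<rbrakk>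
        \<Longrightarrow> (arrow_path2 Q c a \<in> R) \<noteq> (arrow_path2 Q c' a \<in> R)"
    and relation_split_in:
      "\<lbrakk>b \<in> arcs Q; a \<in> arcs Q; a' \<in> arcs Q; a \<noteq> a'; head Q a = tail Q b; head Q a' = tail Q b\<rbrakk>
        \<Longrightarrow> (arrow_path2 Q b a \<in> R) \<noteq> (arrow_path2 Q b a' \<in> R)"
    and relation_rotate:
      "arrow_path2 Q b a \<in> R \<Longrightarrow> \<exists>c. arrow_path2 Q c b \<in> R \<and> arrow_path2 Q a c \<in> R"
begin

abbreviation rel :: "'a \<Rightarrow> 'a \<Rightarrow> bool" where
  "rel b a \<equiv> arrow_path2 Q b a \<in> R"

lemma relD:
  assumes "rel b a"
  shows "a \<in> arcs Q" "b \<in> arcs Q" "head Q a = tail Q b"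
  using assms relation_paths by (auto simp: arrow_path2_def qpaths_iff cas.simps)

text \<open>
  There is at most one summand: the vertex opposite to \<open>q\<close> in the triangle of relations through \<open>q\<close>.
  Without such a triangle, \<open>apex q = 0\<close>.
\<close>

definition apex :: "'a \<Rightarrow> int ^ 'v" where
  "apex q = (\<Sum>a | rel q a. axis (tail Q a) 1)"

text \<open>
  The triangle through \<open>q\<close> closes up: the arrow entering \<open>q\<close> in a relation starts where the arrow
  leaving \<open>q\<close> in a relation ends. This identity is what makes the triangle arrows attached to the
  two ends of \<open>q\<close> cancel.
\<close>

lemma apex_eq_sum_heads: "apex q = (\<Sum>c | rel c q. axis (head Q c) 1)"
proof (cases "\<exists>a. rel q a")
  case True
  then obtain a c where a: "rel q a" and c: "rel c q" "rel a c"
    using relation_rotate by blast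
  have "{a. rel q a} = {a}"
    using a relation_split_in[of q _ a] by (auto intro: relD)
  moreover have "{c. rel c q} = {c}"
    using c relation_split_out[of q _ c] relD by (auto; metis)
  ultimately show ?thesis
    using relD[OF \<open>rel a c\<close>] by (simp add: apex_def)
next
  case False
  then have none: "\<not> rel q a" "\<not> rel a q" for a
    using relation_rotate by blast+
  show ?thesis
    by (simp add: apex_def none)
qed

lemma column_quiver_matrix:
  "column v (quiver_matrix Q) =
     (\<Sum>a\<in>out_arcs Q v. axis (head Q a) 1) - (\<Sum>a\<in>in_arcs Q v. axis (tail Q a) 1)"
proof -
  have "int (card {a \<in> arcs Q. tail Q a = v \<and> head Q a = i})
      = (\<Sum>a\<in>out_arcs Q v. if i = head Q a then 1 else 0)" for i
    by (subst sum.inter_filter[symmetric]) (auto simp: out_arcs_def intro: arg_cong[of _ _ card])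
  moreover have "int (card {a \<in> arcs Q. tail Q a = i \<and> head Q a = v})
      = (\<Sum>a\<in>in_arcs Q v. if i = tail Q a then 1 else 0)" for i
    by (subst sum.inter_filter[symmetric]) (auto simp: in_arcs_def intro: arg_cong[of _ _ card])
  ultimately show ?thesis
    by (simp add: vec_eq_iff column_def quiver_matrix_def axis_def)
qed

lemma out_arcs_after_arrow:
  assumes "p \<in> arcs Q" "q \<in> arcs Q" "head Q p = tail Q q" "\<not> rel q p"
  shows "out_arcs Q (tail Q q) = insert q {c. rel c p}"
  using assms relation_split_out[of p q] by (auto; metis relD)

lemma in_arcs_before_arrow:
  assumes "p \<in> arcs Q" "q \<in> arcs Q" "head Q p = tail Q q" "\<not> rel q p"
  shows "in_arcs Q (tail Q q) = insert p {a. rel q a}"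
  using assms relation_split_in[of q p] by (auto; metis relD)

lemma finite_rel: "finite {a. rel q a}" "finite {c. rel c p}"
  by (rule finite_subset[OF _ finite_arcs]; auto dest: relD)+

text \<open>
  The arrows at this vertex other than \<open>p\<close> and \<open>q\<close> lie in the triangle of \<open>p\<close> if they leave it, and in
  the triangle of \<open>q\<close> if they enter it.
\<close>

lemma column_at_interior_vertex:
  assumes "p \<in> arcs Q" "q \<in> arcs Q" "head Q p = tail Q q" "\<not> rel q p"
  shows "column (tail Q q) (quiver_matrix Q) =
    axis (head Q q) 1 - axis (tail Q p) 1 + apex p - apex q"
proof -
  have "(\<Sum>a\<in>out_arcs Q (tail Q q). axis (head Q a) 1) = axis (head Q q) 1 + apex p"
    using assms(4) by (simp add: out_arcs_after_arrow[OF assms] finite_rel apex_eq_sum_heads)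
  moreover have "(\<Sum>a\<in>in_arcs Q (tail Q q). axis (tail Q a) 1) = axis (tail Q p) 1 + apex q"
    using assms(4) by (simp add: in_arcs_before_arrow[OF assms] finite_rel apex_def)
  ultimately show ?thesis
    by (simp add: column_quiver_matrix)
qed

text \<open>
  By the degree bound \<open>q\<close> and \<open>q'\<close> are all the outgoing arrows, and each incoming arrow is in relation
  with exactly one of them.
\<close>

lemma column_at_branching_vertex:
  assumes "q \<in> arcs Q" "q' \<in> arcs Q" "q \<noteq> q'" "tail Q q' = tail Q q"
  shows "column (tail Q q) (quiver_matrix Q) =
    axis (head Q q) 1 + axis (head Q q') 1 - apex q - apex q'"
proof -
  let ?v = "tail Q q"
  have "card (out_arcs Q ?v) \<le> card {q, q'}"
    using degree_le_2[of ?v] assms by (auto simp: out_degree_def)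
  then have out: "out_arcs Q ?v = {q, q'}"
    using assms by (intro card_seteq[symmetric]) auto
  have "in_arcs Q ?v = {a. rel q a} \<union> {a. rel q' a}" "{a. rel q a} \<inter> {a. rel q' a} = {}"
    using assms relation_split_out[of _ q q'] by (auto) (metis relD)+
  then have "(\<Sum>a\<in>in_arcs Q ?v. axis (tail Q a) 1) = apex q + apex q'"
    by (simp add: apex_def sum.union_disjoint finite_rel)
  with out assms(3) show ?thesis
    by (simp add: column_quiver_matrix)
qed

lemma column_at_merging_vertex:
  assumes "p \<in> arcs Q" "p' \<in> arcs Q" "p \<noteq> p'" "head Q p' = head Q p"
  shows "column (head Q p) (quiver_matrix Q) =
    apex p + apex p' - axis (tail Q p) 1 - axis (tail Q p') 1"
proof -
  let ?v = "head Q p"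
  have "card (in_arcs Q ?v) \<le> card {p, p'}"
    using degree_le_2[of ?v] assms by (auto simp: in_degree_def)
  then have "in_arcs Q ?v = {p, p'}"
    using assms by (intro card_seteq[symmetric]) auto
  moreover have "out_arcs Q ?v = {c. rel c p} \<union> {c. rel c p'}" "{c. rel c p} \<inter> {c. rel c p'} = {}"
    using assms relation_split_in[of _ p p'] by (auto) (metis relD)+
  then have "(\<Sum>a\<in>out_arcs Q ?v. axis (head Q a) 1) = apex p + apex p'"
    by (simp add: apex_eq_sum_heads sum.union_disjoint finite_rel)
  ultimately show ?thesis
    using assms(3) by (simp add: column_quiver_matrix)
qed

text \<open>
  The arrows \<open>b\<close> and \<open>b'\<close> are the first and the last arrow of the detour, so \<open>b = b'\<close> for a bypass.
  Inside the path everything cancels: the triangle of \<open>\<beta> k\<close> is counted with opposite signs at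
  the two ends of \<open>\<beta> k\<close>, and the basis vectors at the ends of the arrows \<open>\<beta> k\<close> telescope.
\<close>

lemma sum_columns_along_path:
  assumes m: "2 \<le> m"
    and path: "\<And>k. \<lbrakk>1 \<le> k; k < m\<rbrakk> \<Longrightarrow> \<beta> k \<in> arcs Q"
      "\<And>k. \<lbrakk>1 \<le> k; Suc k < m\<rbrakk> \<Longrightarrow> head Q (\<beta> k) = tail Q (\<beta> (Suc k))"
      "\<And>k. \<lbrakk>1 \<le> k; Suc k < m\<rbrakk> \<Longrightarrow> \<not> rel (\<beta> (Suc k)) (\<beta> k)"
    and vertices: "\<And>k. \<lbrakk>1 \<le> k; k < m\<rbrakk> \<Longrightarrow> j k = tail Q (\<beta> k)" "j m = head Q (\<beta> (m - 1))"
    and start: "b \<in> arcs Q" "b \<noteq> \<beta> 1" "tail Q b = tail Q (\<beta> 1)"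
    and finish: "b' \<in> arcs Q" "b' \<noteq> \<beta> (m - 1)" "head Q b' = head Q (\<beta> (m - 1))"
  shows "(\<Sum>k = 1..m. column (j k) (quiver_matrix Q)) =
    (axis (head Q b) 1 - axis (j 1) 1 - apex b) + (axis (j m) 1 - axis (tail Q b') 1 + apex b')"
proof -
  let ?e = "\<lambda>v. axis v 1 :: int ^ 'v"
  have head_\<beta>: "head Q (\<beta> k) = j (Suc k)" if "1 \<le> k" "k < m" for k
    using that path(2)[of k] vertices(1)[of "Suc k"] vertices(2) by (cases "Suc k = m") auto
  (* Among the triangles on arrows of the path, only that of \<beta> n still waits for its
     counterpart, which sits at the next vertex. *)
  have partial: "(\<Sum>k = 1..n. column (j k) (quiver_matrix Q)) =
      ?e (head Q b) - ?e (j 1) - apex b + ?e (j n) + ?e (j (Suc n)) - apex (\<beta> n)"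
    if "1 \<le> n" "n < m" for n
    using that
  proof (induction n rule: nat_induct_at_least)
    case base
    have "column (j 1) (quiver_matrix Q)
        = ?e (head Q (\<beta> 1)) + ?e (head Q b) - apex (\<beta> 1) - apex b"
      using base column_at_branching_vertex[of "\<beta> 1" b] path(1)[of 1] start vertices(1)[of 1] by simp
    then show ?case
      using base head_\<beta>[of 1] by simp
  next
    case (Suc n)
    have "column (j (Suc n)) (quiver_matrix Q)
        = ?e (j (Suc (Suc n))) - ?e (j n) + apex (\<beta> n) - apex (\<beta> (Suc n))"
      using Suc.hyps Suc.prems column_at_interior_vertex[of "\<beta> n" "\<beta> (Suc n)"]
        path(1)[of n] path(1)[of "Suc n"] path(2)[of n] path(3)[of n]
        vertices(1)[of n] vertices(1)[of "Suc n"] head_\<beta>[of "Suc n"] by simp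
    with Suc show ?case
      by simp
  qed
  obtain n where n: "m = Suc n" "1 \<le> n"
    using m by (cases m) auto
  have "column (j m) (quiver_matrix Q) = apex (\<beta> n) + apex b' - ?e (j n) - ?e (tail Q b')"
    using column_at_merging_vertex[of "\<beta> n" b'] path(1)[of n] finish vertices(1)[of n] vertices(2) n
    by simp
  then show ?thesis
    using partial[of n] n by simp
qed

text \<open>
  A triangle through \<open>b\<close> would leave the middle vertex of the detour along \<open>b'\<close>, the only arrow that
  starts there, but \<open>b'b\<close> is not a relation; likewise for \<open>b'\<close>.
\<close>

lemma apex_eq_0_at_relation_free_transit:
  assumes "in_arcs Q (head Q b) \<union> out_arcs Q (head Q b) \<subseteq> {b, b'}"
    and "head Q b = tail Q b'" "\<not> rel b' b" "tail Q b \<noteq> head Q b" "tail Q b' \<noteq> head Q b'"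
  shows "apex b = 0" "apex b' = 0"
proof -
  have none: "\<not> rel c b" "\<not> rel b' c" for c
    using assms relD[of c b] relD[of b' c] by fastforce+
  show "apex b = 0"
    by (simp add: apex_eq_sum_heads none)
  show "apex b' = 0"
    by (simp add: apex_def none)
qed

end

section \<open>Bypasses and almost bypasses\<close>

lemma triangle_relations_gentle_qp:
  assumes "fin_digraph Q" and gentle: "gentle_qp Q S"
  shows "triangle_relations Q (derivative_paths Q S)"
proof -
  interpret fin_digraph Q by fact
  have pair: "gentle_pair Q (derivative_paths Q S)"
    using gentle by (simp add: gentle_qp_def)
  have split_out: "\<forall>a \<in> arcs Q. \<forall>c \<in> arcs Q. \<forall>c' \<in> arcs Q.
       c \<noteq> c' \<and> head Q a = tail Q c \<and> head Q a = tail Q c' \<longrightarrow>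
       (arrow_path2 Q c a \<in> derivative_paths Q S) \<noteq> (arrow_path2 Q c' a \<in> derivative_paths Q S)"
    using pair unfolding gentle_pair_def by (elim conjE)
  have split_in: "\<forall>b \<in> arcs Q. \<forall>a \<in> arcs Q. \<forall>a' \<in> arcs Q.
       a \<noteq> a' \<and> head Q a = tail Q b \<and> head Q a' = tail Q b \<longrightarrow>
       (arrow_path2 Q b a \<in> derivative_paths Q S) \<noteq> (arrow_path2 Q b a' \<in> derivative_paths Q S)"
    using pair unfolding gentle_pair_def by (elim conjE)
  show ?thesis
  proof
    show "\<exists>c. arrow_path2 Q c b \<in> derivative_paths Q S \<and> arrow_path2 Q a c \<in> derivative_paths Q S"
      if "arrow_path2 Q b a \<in> derivative_paths Q S" for a b
      using gentle_qp_relations_rotate[OF gentle that] by blast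
  next
    show "(arrow_path2 Q c a \<in> derivative_paths Q S) \<noteq> (arrow_path2 Q c' a \<in> derivative_paths Q S)"
      if "a \<in> arcs Q" "c \<in> arcs Q" "c' \<in> arcs Q" "c \<noteq> c'"
        "head Q a = tail Q c" "head Q a = tail Q c'" for a c c'
      using split_out that by blast
  next
    show "(arrow_path2 Q b a \<in> derivative_paths Q S) \<noteq> (arrow_path2 Q b a' \<in> derivative_paths Q S)"
      if "b \<in> arcs Q" "a \<in> arcs Q" "a' \<in> arcs Q" "a \<noteq> a'"
        "head Q a = tail Q b" "head Q a' = tail Q b" for b a a'
      using split_in that by blast
  qed (use pair in \<open>auto simp: gentle_pair_def\<close>)
qed

lemma cas_consecutive:
  "pre_digraph.cas Q u as v \<Longrightarrow> Suc i < length as \<Longrightarrow> head Q (as ! i) = tail Q (as ! Suc i)"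
proof (induction as arbitrary: u i)
  case (Cons a as)
  then show ?case
    by (cases i; cases as) (auto simp: pre_digraph.cas.simps)
qed simp

theorem proposition6p4:
  fixes Q :: "('v::finite, 'a) pre_digraph"
    and S :: "('v, 'a) qpath \<Rightarrow> complex"
    and m :: nat
    and \<beta> :: "nat \<Rightarrow> 'a"
    and j :: "nat \<Rightarrow> 'v"
    and \<pi> :: "('v, 'a) qpath"
  assumes "fin_digraph Q"
    and "verts Q = UNIV"
    and "gentle_qp Q S"
    and "\<pi> = (tail Q (\<beta> 1), map \<beta> [1..<m])"
    and "is_bypass Q (derivative_paths Q S) \<pi> \<or> is_almost_bypass Q (derivative_paths Q S) \<pi>"
    and "\<And>k. k \<in> {1..m - 1} \<Longrightarrow> j k = tail Q (\<beta> k)"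
    and "j m = head Q (\<beta> (m - 1))"
  shows "(is_bypass Q (derivative_paths Q S) \<pi> \<longrightarrow>
            (\<Sum>k = 1..m. column (j k) (quiver_matrix Q)) = 2 *s (- axis (j 1) 1 + axis (j m) 1)) \<and>
         (is_almost_bypass Q (derivative_paths Q S) \<pi> \<longrightarrow>
            (\<Sum>k = 1..m. column (j k) (quiver_matrix Q)) = - axis (j 1) 1 + axis (j m) 1)"
proof -
  let ?R = "derivative_paths Q S"
  let ?B = "quiver_matrix Q"
  interpret triangle_relations Q ?R
    using assms(1,3) by (rule triangle_relations_gentle_qp)
  have loopfree: "tail Q a \<noteq> head Q a" if "a \<in> arcs Q" for a
    using assms(3) that by (auto simp: gentle_qp_def loopfree_digraph_def loopfree_digraph_axioms_def)
  have path: "\<pi> \<in> qpaths Q" "snd \<pi> \<noteq> []" "relation_free Q ?R (snd \<pi>)"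
    using assms(5) by (auto simp: is_bypass_def is_almost_bypass_def)
  have m: "2 \<le> m" and ends: "hd (snd \<pi>) = \<beta> 1" "last (snd \<pi>) = \<beta> (m - 1)"
    using path(2) assms(4) by (auto simp: hd_map last_map)
  have nth: "snd \<pi> ! i = \<beta> (Suc i)" if "Suc i < m" for i
    using that assms(4) by simp
  have len: "length (snd \<pi>) = m - 1"
    using assms(4) by simp
  have arrows: "\<beta> k \<in> arcs Q" if "1 \<le> k" "k < m" for k
    using that path(1) assms(4) by (auto simp: qpaths_iff)
  have consecutive: "head Q (\<beta> k) = tail Q (\<beta> (Suc k))" "\<not> rel (\<beta> (Suc k)) (\<beta> k)"
    if "1 \<le> k" "Suc k < m" for k
    using that path(1,3) nth[of "k - 1"] nth[of k] len
      cas_consecutive[of Q "fst \<pi>" "snd \<pi>" "qtarget Q \<pi>" "k - 1"]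
    by (auto simp: qpaths_iff relation_free_def dest!: spec[of _ "k - 1"])
  have j: "j k = tail Q (\<beta> k)" if "1 \<le> k" "k < m" for k
    using that assms(6) by simp
  note column_sum = sum_columns_along_path[of m \<beta> j, OF m arrows consecutive j assms(7)]
  show ?thesis
  proof (intro conjI impI)
    assume "is_bypass Q ?R \<pi>"
    then obtain b where b: "b \<in> arcs Q" "b \<noteq> \<beta> 1" "b \<noteq> \<beta> (m - 1)"
      "tail Q b = tail Q (\<beta> 1)" "head Q b = head Q (\<beta> (m - 1))"
      using ends by (auto simp: is_bypass_def)
    have "(\<Sum>k = 1..m. column (j k) ?B) =
        (axis (j m) 1 - axis (j 1) 1 - apex b) + (axis (j m) 1 - axis (j 1) 1 + apex b)"
      using column_sum[of b b] b j[of 1] assms(7) m by simp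
    then show "(\<Sum>k = 1..m. column (j k) ?B) = 2 *s (- axis (j 1) 1 + axis (j m) 1)"
      by (simp add: vec_eq_iff)
  next
    assume "is_almost_bypass Q ?R \<pi>"
    then obtain b b' where b: "b \<in> arcs Q" "b \<noteq> \<beta> 1" "tail Q b = tail Q (\<beta> 1)"
      and b': "b' \<in> arcs Q" "b' \<noteq> \<beta> (m - 1)" "head Q b' = head Q (\<beta> (m - 1))"
      and transit: "head Q b = tail Q b'" "\<not> rel b' b"
        "in_arcs Q (head Q b) \<union> out_arcs Q (head Q b) = {b, b'}"
      unfolding is_almost_bypass_def ends by blast
    have "apex b = 0" "apex b' = 0"
      by (rule apex_eq_0_at_relation_free_transit[OF equalityD1[OF transit(3)] transit(1,2)
            loopfree[OF b(1)] loopfree[OF b'(1)]])+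
    then show "(\<Sum>k = 1..m. column (j k) ?B) = - axis (j 1) 1 + axis (j m) 1"
      using column_sum[of b b'] b b' transit by simp
  qed
qed

end
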